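(* Let $(G,d)$ be an abelian, metrizable, non-discrete topological group, where $d$ is a translation-invariant metric inducing the topology of $G$. The following assertions are equivalent: (i) $G$ is not locally bounded; (ii) there exists a non-discrete UFSS group topology on $G$ finer than the topology of $G$; (iii) there exists a non-discrete UFSS group topology on $G$ strictly finer than the topology of $G$; (iv) there exists an almost independent sequence in $G$ (with respect to $d$).
   Context: $\mathbb N=\{1,2,\dots\}$. For an abelian group $G$ and $n\in\mathbb N$, $G[n]=\{x\in G: nx=0\}$. An abelian topological group $G$ is called locally bounded if there is some $n\in\mathbb N$ such that the subgroup $G[n]$ is open. For a symmetric subset $U\ni 0$ of $G$ and $n\in\mathbb N$ put $(1/n)U=\{x\in G: kx\in U\ \text{for all } k\in\{1,\dots,n\}\}$. A Hausdorff group topology is UFSS if for some neighborhood $U$ of $0$ (which may be taken symmetric) the sets $(1/n)U$, $n\in\mathbb N$, form a neighborhood basis at $0$. Put $v(x)=d(x,0)$ for $x\in G$. A sequence $(x_n)_{n\ge 0}$ in $G$ is nearly independent if for every finitely supported integer sequence $(a_j)_{j\ge0}$ with $|a_j|\le 2^{j+2}$ for all $j$, $\sum_{j} a_jx_j=0$ implies $a_j=0$ for all $j$. For a nearly independent sequence $(x_n)$ and $n\ge 0$ let $$\varepsilon_n=\min\Big\{v\Big(\sum_{j=0}^n a_jx_j\Big): a_j\in\mathbb Z,\ |a_j|\le 2^{j+2}\ (0\le j\le n),\ (a_0,\dots,a_n)\neq 0\Big\}>0 .$$ A nearly independent sequence $(x_n)_{n\ge0}$ is called almost independent if $2^{n+3}v(x_{n+1})<\varepsilon_n\le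 v(x_n)$ for all $n\ge 0$. *)

theory Defs
  imports "HOL-Analysis.Analysis"
begin

section \<open>Integer multiples in an abelian group\<close>

primrec nmult :: "nat \<Rightarrow> 'a::ab_group_add \<Rightarrow> 'a" where
  "nmult 0 x = 0"
| "nmult (Suc n) x = x + nmult n x"

definition zmult :: "int \<Rightarrow> 'a::ab_group_add \<Rightarrow> 'a" where
  "zmult k x = (if 0 \<le> k then nmult (nat k) x else - nmult (nat (- k)) x)"

definition torsion_part :: "nat \<Rightarrow> 'a::ab_group_add set" where
  "torsion_part n = {x. nmult n x = 0}"


section \<open>Group topologies\<close>

text \<open>The group is the whole type. Topologies on it are abstract topologies, so that several
  group topologies on the same group can be compared. Group topologies are not required to be
  Hausdorff; this is part of \<open>UFSS\<close> and automatic for metrizable ones.\<close>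

definition group_topology :: "'a::ab_group_add topology \<Rightarrow> bool" where
  "group_topology T \<longleftrightarrow>
     topspace T = UNIV \<and>
     continuous_map (prod_topology T T) T (\<lambda>(x, y). x + y) \<and>
     continuous_map T T uminus"

definition nbhd_zero :: "'a::ab_group_add topology \<Rightarrow> 'a set \<Rightarrow> bool" where
  "nbhd_zero T U \<longleftrightarrow> (\<exists>V. openin T V \<and> 0 \<in> V \<and> V \<subseteq> U)"

definition is_discrete :: "'a topology \<Rightarrow> bool" where
  "is_discrete T \<longleftrightarrow> T = discrete_topology (topspace T)"

definition finer_than :: "'a topology \<Rightarrow> 'a topology \<Rightarrow> bool" where
  "finer_than T' T \<longleftrightarrow> topspace T' = topspace T \<and> (\<forall>V. openin T V \<longrightarrow> openin T' V)"

definition strictly_finer_than :: "'a topology \<Rightarrow> 'a topology \<Rightarrow> bool" where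
  "strictly_finer_than T' T \<longleftrightarrow> finer_than T' T \<and> T' \<noteq> T"

definition locally_bounded :: "'a::ab_group_add topology \<Rightarrow> bool" where
  "locally_bounded T \<longleftrightarrow> (\<exists>n\<ge>1. openin T (torsion_part n))"

text \<open>\<open>frac_set n U\<close> is \<open>(1/n)U\<close>.\<close>

definition frac_set :: "nat \<Rightarrow> 'a::ab_group_add set \<Rightarrow> 'a set" where
  "frac_set n U = {x. \<forall>k\<in>{1..n}. nmult k x \<in> U}"

definition UFSS :: "'a::ab_group_add topology \<Rightarrow> bool" where
  "UFSS T \<longleftrightarrow>
     group_topology T \<and> Hausdorff_space T \<and>
     (\<exists>U. nbhd_zero T U \<and> uminus ` U = U \<and>
          (\<forall>n\<ge>1. nbhd_zero T (frac_set n U)) \<and>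
          (\<forall>W. nbhd_zero T W \<longrightarrow> (\<exists>n\<ge>1. frac_set n U \<subseteq> W)))"


section \<open>Nearly and almost independent sequences\<close>

definition nearly_independent :: "(nat \<Rightarrow> 'a::ab_group_add) \<Rightarrow> bool" where
  "nearly_independent x \<longleftrightarrow>
     (\<forall>a :: nat \<Rightarrow> int.
        finite {j. a j \<noteq> 0} \<longrightarrow> (\<forall>j. \<bar>a j\<bar> \<le> 2 ^ (j + 2)) \<longrightarrow>
        (\<Sum>j | a j \<noteq> 0. zmult (a j) (x j)) = 0 \<longrightarrow> (\<forall>j. a j = 0))"

text \<open>The values whose minimum is \<open>\<epsilon>\<^sub>n\<close>; coefficients with index above \<open>n\<close> are irrelevant.\<close>

definition eps_values ::
    "('a::ab_group_add \<Rightarrow> 'a \<Rightarrow> real) \<Rightarrow> (nat \<Rightarrow> 'a) \<Rightarrow> nat \<Rightarrow> real set" where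
  "eps_values d x n =
     {d (\<Sum>j\<le>n. zmult (a j) (x j)) 0 | a :: nat \<Rightarrow> int.
        (\<forall>j\<le>n. \<bar>a j\<bar> \<le> 2 ^ (j + 2)) \<and> (\<exists>j\<le>n. a j \<noteq> 0)}"

definition eps :: "('a::ab_group_add \<Rightarrow> 'a \<Rightarrow> real) \<Rightarrow> (nat \<Rightarrow> 'a) \<Rightarrow> nat \<Rightarrow> real" where
  "eps d x n = Min (eps_values d x n)"

definition almost_independent ::
    "('a::ab_group_add \<Rightarrow> 'a \<Rightarrow> real) \<Rightarrow> (nat \<Rightarrow> 'a) \<Rightarrow> bool" where
  "almost_independent d x \<longleftrightarrow>
     nearly_independent x \<and>
     (\<forall>n. 2 ^ (n + 3) * d (x (n + 1)) 0 < eps d x n \<and> eps d x n \<le> d (x n) 0)"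

text \<open>The minimum defining \<open>\<epsilon>\<^sub>n\<close> is taken over a finite nonempty set.\<close>

lemma finite_eps_values: "finite (eps_values d x n)"
proof -
  let ?A = "PiE {..n} (\<lambda>j. {- (2 ^ (j + 2)) .. 2 ^ (j + 2) :: int})"
  have "eps_values d x n \<subseteq> (\<lambda>a. d (\<Sum>j\<le>n. zmult (a j) (x j)) 0) ` ?A"
  proof
    fix r assume "r \<in> eps_values d x n"
    then obtain a :: "nat \<Rightarrow> int"
      where r: "r = d (\<Sum>j\<le>n. zmult (a j) (x j)) 0" and a: "\<forall>j\<le>n. \<bar>a j\<bar> \<le> 2 ^ (j + 2)"
      unfolding eps_values_def by blast
    have "restrict a {..n} \<in> ?A"
      using a by (auto simp: abs_le_iff minus_le_iff)
    moreover have "r = d (\<Sum>j\<le>n. zmult (restrict a {..n} j) (x j)) 0"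
      unfolding r by simp
    ultimately show "r \<in> (\<lambda>a. d (\<Sum>j\<le>n. zmult (a j) (x j)) 0) ` ?A"
      by blast
  qed
  then show ?thesis
    by (rule finite_subset) (auto intro: finite_PiE)
qed

lemma eps_values_nonempty: "eps_values d x n \<noteq> {}"
proof -
  have "(1 :: int) \<le> 2 ^ (j + 2)" for j
    by (rule one_le_power) simp
  then show ?thesis
    unfolding eps_values_def by (auto intro!: exI[of _ "\<lambda>_. 1"])
qed

end

theory Submission
  imports Defs
begin

text \<open>If a Hausdorff topology has the UFSS witness \<open>U\<close> and \<open>G[n]\<close> is open in it, then a point of
  \<open>G[n] \<inter> (1/n)U\<close> has all its multiples in \<open>U\<close>, so it is \<open>0\<close> and the topology is discrete.
  If no \<open>G[n]\<close> is open, arbitrarily small elements of arbitrarily large order exist, and an almost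
  independent sequence is chosen greedily. From such a sequence \<open>x\<close>, the sets of combinations
  \<open>\<Sum> a\<^sub>j x\<^sub>j\<close> with \<open>\<bar>a\<^sub>j\<bar> \<le> 2\<^sup>j\<^sup>-\<^sup>n\<close> form a base at \<open>0\<close> of a UFSS topology: near independence
  makes doubling act on coefficients. The points \<open>2\<^sup>j\<^sup>+\<^sup>1 x\<^sub>j\<close> tend to \<open>0\<close> in the original topology
  only, so the new one is strictly finer.\<close>

section \<open>Integer multiples\<close>

lemma nmult_add: "nmult (m + n) x = nmult m x + nmult n x"
  by (induction m) (simp_all add: algebra_simps)

lemma nmult_add_right: "nmult n (x + y) = nmult n x + nmult n y"
  by (induction n) (simp_all add: algebra_simps)

lemma nmult_zero_right [simp]: "nmult n 0 = 0"
  by (induction n) simp_all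

lemma nmult_mult: "nmult (m * n) x = nmult m (nmult n x)"
  by (induction m) (simp_all add: nmult_add)

lemma nmult_mod:
  assumes "nmult n x = 0"
  shows "nmult m x = nmult (m mod n) x"
proof -
  have "nmult m x = nmult (m div n * n + m mod n) x"
    by simp
  also have "\<dots> = nmult (m mod n) x"
    unfolding nmult_add nmult_mult assms by simp
  finally show ?thesis .
qed

lemma zmult_diff_nat: "zmult (int m - int n) x = nmult m x - nmult n x"
proof (cases "n \<le> m")
  case True
  then obtain k where "m = n + k"
    by (auto simp: le_iff_add)
  then show ?thesis
    by (simp add: zmult_def nmult_add)
next
  case False
  then obtain k where k: "n = m + k" "k > 0"
    by (metis less_imp_add_positive not_le)
  then have "nat (- (int m - int n)) = k"
    by simp
  with k show ?thesis
    by (simp add: zmult_def nmult_add)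
qed

lemma zmult_of_nat [simp]: "zmult (int n) x = nmult n x"
  using zmult_diff_nat[of n 0] by simp

lemma zmult_zero_left [simp]: "zmult 0 x = 0"
  by (simp add: zmult_def)

lemma zmult_one_left [simp]: "zmult 1 x = x"
  by (simp add: zmult_def)

lemma zmult_add: "zmult (a + b) x = zmult a x + zmult b x"
proof -
  obtain m n where a: "a = int m - int n"
    by (rule int_diff_cases)
  obtain p q where b: "b = int p - int q"
    by (rule int_diff_cases)
  have "a + b = int (m + p) - int (n + q)"
    by (simp add: a b)
  then show ?thesis
    unfolding a b by (simp only: zmult_diff_nat nmult_add) (simp add: algebra_simps)
qed

lemma zmult_minus: "zmult (- a) x = - zmult a x"
  using zmult_add[of "- a" a x] by (simp add: eq_neg_iff_add_eq_0)


section \<open>Topologies from neighbourhood bases at zero\<close>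

text \<open>Axioms for a countable base at zero of a group topology: \<open>halving\<close> yields
  continuity of addition. Separation is not built in and comes later from a comparison with the
  metric topology.\<close>

locale zero_base =
  fixes U :: "nat \<Rightarrow> 'a::ab_group_add set"
  assumes zero_mem: "0 \<in> U n"
    and decreasing: "U (Suc n) \<subseteq> U n"
    and uminus_mem: "x \<in> U n \<Longrightarrow> - x \<in> U n"
    and halving: "x \<in> U (Suc n) \<Longrightarrow> y \<in> U (Suc n) \<Longrightarrow> x + y \<in> U n"
begin

lemma antimono: "m \<le> n \<Longrightarrow> U n \<subseteq> U m"
  by (rule lift_Suc_antimono_le[of U]) (use decreasing in auto)

definition base_topology :: "'a topology" where
  "base_topology = topology (\<lambda>V. \<forall>x\<in>V. \<exists>n. \<forall>u\<in>U n. x + u \<in> V)"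

lemma openin_base_topology:
  "openin base_topology V \<longleftrightarrow> (\<forall>x\<in>V. \<exists>n. \<forall>u\<in>U n. x + u \<in> V)"
proof -
  have "istopology (\<lambda>V. \<forall>x\<in>V. \<exists>n. \<forall>u\<in>U n. x + u \<in> V)"
    unfolding istopology_def
  proof (intro conjI allI impI ballI)
    fix S T x
    assume S: "\<forall>x\<in>S. \<exists>n. \<forall>u\<in>U n. x + u \<in> S" and T: "\<forall>x\<in>T. \<exists>n. \<forall>u\<in>U n. x + u \<in> T"
      and x: "x \<in> S \<inter> T"
    from x S obtain m where m: "\<forall>u\<in>U m. x + u \<in> S" by blast
    from x T obtain n where n: "\<forall>u\<in>U n. x + u \<in> T" by blast
    have "\<forall>u\<in>U (max m n). x + u \<in> S \<inter> T"
      using m n antimono[of m "max m n"] antimono[of n "max m n"] by auto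
    then show "\<exists>n. \<forall>u\<in>U n. x + u \<in> S \<inter> T" ..
  next
    fix K x
    assume K: "\<forall>V\<in>K. \<forall>x\<in>V. \<exists>n. \<forall>u\<in>U n. x + u \<in> V" and "x \<in> \<Union>K"
    then obtain V where V: "V \<in> K" "x \<in> V" by blast
    with K obtain n where "\<forall>u\<in>U n. x + u \<in> V" by blast
    with V show "\<exists>n. \<forall>u\<in>U n. x + u \<in> \<Union>K" by blast
  qed
  then show ?thesis
    unfolding base_topology_def by (simp add: topology_inverse')
qed

lemma topspace_base_topology [simp]: "topspace base_topology = UNIV"
proof -
  have "openin base_topology UNIV"
    by (simp add: openin_base_topology)
  then show ?thesis
    using openin_subset by blast
qed

text \<open>The set of points with a basic neighbourhood inside \<open>U n\<close> around them is open by halving.\<close>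

lemma open_core:
  obtains V where "openin base_topology V" "x \<in> V" "\<And>y. y \<in> V \<Longrightarrow> y - x \<in> U n"
proof
  let ?V = "{y. \<exists>m. \<forall>u\<in>U m. y + u - x \<in> U n}"
  show "openin base_topology ?V"
    unfolding openin_base_topology
  proof
    fix y assume "y \<in> ?V"
    then obtain m where m: "\<forall>u\<in>U m. y + u - x \<in> U n" by blast
    \<comment> \<open>If \<open>U m\<close> witnesses \<open>y\<close>, then
      \<open>U (Suc m)\<close> witnesses every \<open>y + u\<close> with \<open>u\<close> in
      \<open>U (Suc m)\<close>, because the displacement \<open>u + w\<close> lies in
      \<open>U m\<close>.\<close>
    have "y + u + w - x \<in> U n" if "u \<in> U (Suc m)" "w \<in> U (Suc m)" for u w
      using m halving[OF that] by (simp add: add.assoc)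
    then show "\<exists>m. \<forall>u\<in>U m. y + u \<in> ?V" by blast
  qed
  show "x \<in> ?V"
    by auto
  show "y - x \<in> U n" if "y \<in> ?V" for y
  proof -
    from that obtain m where m: "\<forall>u\<in>U m. y + u - x \<in> U n" by blast
    show ?thesis
      using bspec[OF m zero_mem] by simp
  qed
qed

text \<open>The sets \<open>U n\<close> may fail to be open, so \<open>open_core\<close> at 0
  supplies an open set inside \<open>U n\<close>.\<close>

lemma nbhd_zero_base_topology: "nbhd_zero base_topology W \<longleftrightarrow> (\<exists>n. U n \<subseteq> W)"
proof
  assume "nbhd_zero base_topology W"
  then show "\<exists>n. U n \<subseteq> W"
    unfolding nbhd_zero_def openin_base_topology by fastforce
next
  assume "\<exists>n. U n \<subseteq> W"
  then obtain n where "U n \<subseteq> W" ..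
  moreover obtain V where "openin base_topology V" "0 \<in> V" "\<And>y. y \<in> V \<Longrightarrow> y - 0 \<in> U n"
    using open_core[where x = 0 and n = n] by blast
  ultimately show "nbhd_zero base_topology W"
    unfolding nbhd_zero_def by (metis diff_zero subset_iff)
qed

lemma group_topology_base_topology: "group_topology base_topology"
  unfolding group_topology_def
proof (intro conjI)
  show "continuous_map (prod_topology base_topology base_topology) base_topology (\<lambda>(x, y). x + y)"
    unfolding continuous_map_def
  proof (intro conjI allI impI)
    fix W assume W: "openin base_topology W"
    show "openin (prod_topology base_topology base_topology)
      {p \<in> topspace (prod_topology base_topology base_topology). (case p of (x, y) \<Rightarrow> x + y) \<in> W}"
      unfolding openin_prod_topology_alt
    proof (intro allI impI)
      fix x y
      assume "(x, y) \<in> {p \<in> topspace (prod_topology base_topology base_topology).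
        (case p of (x, y) \<Rightarrow> x + y) \<in> W}"
      then obtain n where n: "\<forall>u\<in>U n. x + y + u \<in> W"
        using W by (auto simp: openin_base_topology)
      obtain A where A: "openin base_topology A" "x \<in> A" "\<And>z. z \<in> A \<Longrightarrow> z - x \<in> U (Suc n)"
        using open_core[where x = x and n = "Suc n"] by blast
      obtain B where B: "openin base_topology B" "y \<in> B" "\<And>z. z \<in> B \<Longrightarrow> z - y \<in> U (Suc n)"
        using open_core[where x = y and n = "Suc n"] by blast
      have "a + b \<in> W" if "a \<in> A" "b \<in> B" for a b
      proof -
        have "x + y + ((a - x) + (b - y)) \<in> W"
          using n halving[OF A(3)[OF that(1)] B(3)[OF that(2)]] by blast
        then show ?thesis by (simp add: algebra_simps)
      qed
      with A B show "\<exists>A B. openin base_topology A \<and> openin base_topology B \<and> x \<in> A \<and> y \<in> B \<and>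
        A \<times> B \<subseteq> {p \<in> topspace (prod_topology base_topology base_topology).
          (case p of (x, y) \<Rightarrow> x + y) \<in> W}"
        by (intro exI[of _ A] exI[of _ B]) auto
    qed
  qed auto
  show "continuous_map base_topology base_topology uminus"
    unfolding continuous_map_def
  proof (intro conjI allI impI)
    fix W assume W: "openin base_topology W"
    show "openin base_topology {x \<in> topspace base_topology. - x \<in> W}"
      unfolding openin_base_topology
    proof
      fix x assume "x \<in> {x \<in> topspace base_topology. - x \<in> W}"
      then obtain n where n: "\<forall>u\<in>U n. - x + u \<in> W"
        using W by (auto simp: openin_base_topology)
      have "- (x + u) \<in> W" if "u \<in> U n" for u
        using bspec[OF n uminus_mem[OF that]] by simp
      then show "\<exists>n. \<forall>u\<in>U n. x + u \<in> {x \<in> topspace base_topology. - x \<in> W}"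
        by auto
    qed
  qed auto
qed simp

end


section \<open>Discreteness and UFSS topologies\<close>

lemma openin_translation:
  assumes "group_topology T" "openin T V"
  shows "openin T ((\<lambda>x. x + a) ` V)"
proof -
  have top: "topspace T = UNIV"
    and add: "continuous_map (prod_topology T T) T (\<lambda>(x, y). x + y)"
    using assms(1) unfolding group_topology_def by auto
  have "continuous_map T T (\<lambda>x. (\<lambda>(x, y). x + y) (x, - a))"
    by (rule continuous_map_compose[OF _ add, unfolded o_def])
      (auto simp: continuous_map_pairedI top)
  then have "openin T {x \<in> topspace T. x + - a \<in> V}"
    using assms(2) by (simp add: continuous_map_def)
  also have "{x \<in> topspace T. x + - a \<in> V} = (\<lambda>x. x + a) ` V"
    by (auto simp: top image_iff algebra_simps)
      (metis diff_add_cancel)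
  finally show ?thesis .
qed

lemma is_discrete_iff_open_zero:
  assumes "group_topology T"
  shows "is_discrete T \<longleftrightarrow> openin T {0}"
proof
  assume "is_discrete T"
  then have "T = discrete_topology (topspace T)"
    by (simp add: is_discrete_def)
  then show "openin T {0}"
    using assms unfolding group_topology_def by (metis UNIV_I empty_subsetI insert_subset openin_discrete_topology)
next
  assume "openin T {0}"
  then have "openin T {x}" for x
    using openin_translation[OF assms, of "{0}" x] by simp
  then show "is_discrete T"
    unfolding is_discrete_def by (metis discrete_topology_unique)
qed

lemma is_discrete_iff_nbhd_zero:
  assumes "group_topology T"
  shows "is_discrete T \<longleftrightarrow> nbhd_zero T {0}"
  unfolding is_discrete_iff_open_zero[OF assms] nbhd_zero_def
  by (metis order_refl singletonD singletonI subset_antisym subset_singletonD empty_iff)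

lemma UFSS_torsion_open_imp_discrete:
  assumes "UFSS T" "openin T (torsion_part n)" "n \<ge> 1"
  shows "is_discrete T"
proof -
  obtain U where T: "group_topology T" "Hausdorff_space T"
    and U: "nbhd_zero T U" "\<And>n. n \<ge> 1 \<Longrightarrow> nbhd_zero T (frac_set n U)"
    and base: "\<And>W. nbhd_zero T W \<Longrightarrow> \<exists>n\<ge>1. frac_set n U \<subseteq> W"
    using assms(1) unfolding UFSS_def by blast
  have zero: "0 \<in> U"
    using U(1) unfolding nbhd_zero_def by blast
  obtain V where V: "openin T V" "0 \<in> V" "V \<subseteq> frac_set n U"
    using U(2)[OF assms(3)] unfolding nbhd_zero_def by blast
  have "x = 0" if x: "x \<in> torsion_part n \<inter> V" for x
  proof (rule ccontr)
    assume "x \<noteq> 0"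
    then obtain W where W: "openin T W" "0 \<in> W" "x \<notin> W"
      using T unfolding Hausdorff_space_def group_topology_def disjnt_iff by (metis UNIV_I)
    \<comment> \<open>The multiples of \<open>x\<close> are periodic with period \<open>n\<close>,
      so membership in \<open>(1/n)U\<close> controls all of them and \<open>x\<close> lies in every
      \<open>(1/m)U\<close>.\<close>
    have "nmult k x \<in> U" for k
    proof -
      have "nmult (k mod n) x \<in> U"
      \<comment> \<open>Residue 0 is outside the range \<open>{1..n}\<close> used by
        \<open>frac_set\<close>; it is covered by \<open>0 \<in> U\<close> instead.\<close>
      proof (cases "k mod n = 0")
        case True
        then show ?thesis by (simp add: zero)
      next
        case False
        moreover have "k mod n \<le> n"
          using assms(3) by (simp add: less_imp_le)
        ultimately show ?thesis
          using x V(3) by (auto simp: frac_set_def)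
      qed
      then show ?thesis
        using x nmult_mod[of n x k] by (simp add: torsion_part_def)
    qed
    moreover obtain m where "frac_set m U \<subseteq> W"
      using base[of W] W unfolding nbhd_zero_def by blast
    ultimately show False
      using W(3) by (auto simp: frac_set_def)
  qed
  then have "torsion_part n \<inter> V = {0}"
    using V(2) by (auto simp: torsion_part_def)
  then show ?thesis
    using is_discrete_iff_open_zero[OF T(1)] assms(2) V(1) by (metis openin_Int)
qed


section \<open>Finitely supported integer combinations\<close>

text \<open>A sum over an infinite index set is 0 by convention, so the laws for adding and
  multiplying combinations carry finite support as a hypothesis.\<close>

definition combination :: "(nat \<Rightarrow> 'a::ab_group_add) \<Rightarrow> (nat \<Rightarrow> int) \<Rightarrow> 'a" where
  "combination x a = (\<Sum>j | a j \<noteq> 0. zmult (a j) (x j))"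

lemma combination_superset:
  assumes "finite A" "{j. a j \<noteq> 0} \<subseteq> A"
  shows "combination x a = (\<Sum>j\<in>A. zmult (a j) (x j))"
  unfolding combination_def by (rule sum.mono_neutral_left) (use assms in auto)

lemma combination_zero [simp]: "combination x (\<lambda>_. 0) = 0"
  by (simp add: combination_def)

lemma finite_supp_add:
  fixes a b :: "nat \<Rightarrow> int"
  assumes "finite {j. a j \<noteq> 0}" "finite {j. b j \<noteq> 0}"
  shows "finite {j. a j + b j \<noteq> 0}"
  by (rule finite_subset[of _ "{j. a j \<noteq> 0} \<union> {j. b j \<noteq> 0}"]) (use assms in auto)

lemma combination_add:
  assumes "finite {j. a j \<noteq> 0}" "finite {j. b j \<noteq> 0}"
  shows "combination x (\<lambda>j. a j + b j) = combination x a + combination x b"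
proof -
  let ?A = "{j. a j \<noteq> 0} \<union> {j. b j \<noteq> 0}"
  have "finite ?A"
    using assms by simp
  moreover have "{j. a j + b j \<noteq> 0} \<subseteq> ?A"
    by auto
  ultimately show ?thesis
    by (simp add: combination_superset[of ?A] zmult_add sum.distrib)
qed

lemma combination_minus: "combination x (\<lambda>j. - a j) = - combination x a"
  by (simp add: combination_def zmult_minus sum_negf)

lemma combination_nmult:
  assumes "finite {j. a j \<noteq> 0}"
  shows "combination x (\<lambda>j. int k * a j) = nmult k (combination x a)"
proof (induction k)
  case (Suc k)
  have "finite {j. int k * a j \<noteq> 0}"
    using assms by (rule rev_finite_subset) auto
  then have "combination x (\<lambda>j. a j + int k * a j) = combination x a + nmult k (combination x a)"
    by (simp add: combination_add[OF assms] Suc)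
  then show ?case
    by (simp add: algebra_simps)
qed simp

lemma combination_single: "combination x ((\<lambda>_. 0)(i := k)) = zmult k (x i)"
  by (subst combination_superset[of "{i}"]) auto

text \<open>The bound \<open>\<bar>a j\<bar> \<le> 2^j / 2^n\<close> is cleared of its denominator
  to stay within the integers. It forces \<open>a j = 0\<close> for \<open>j < n\<close>.\<close>

definition comb_base :: "(nat \<Rightarrow> 'a::ab_group_add) \<Rightarrow> nat \<Rightarrow> 'a set" where
  "comb_base x n = {combination x a | a. finite {j. a j \<noteq> 0} \<and> (\<forall>j. 2 ^ n * \<bar>a j\<bar> \<le> 2 ^ j)}"

lemma comb_baseI:
  "finite {j. a j \<noteq> 0} \<Longrightarrow> (\<And>j. 2 ^ n * \<bar>a j\<bar> \<le> 2 ^ j) \<Longrightarrow> combination x a \<in> comb_base x n"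
  unfolding comb_base_def by blast

lemma comb_baseE:
  assumes "y \<in> comb_base x n"
  obtains a where "finite {j. a j \<noteq> 0}" "\<And>j. 2 ^ n * \<bar>a j\<bar> \<le> 2 ^ j" "y = combination x a"
  using assms unfolding comb_base_def by blast

text \<open>Halving is the triangle inequality for coefficients: two bounds
  \<open>2^j / 2^(n+1)\<close> add up to \<open>2^j / 2^n\<close>.\<close>

interpretation comb: zero_base "comb_base x" for x :: "nat \<Rightarrow> 'a::ab_group_add"
proof
  fix n
  show "0 \<in> comb_base x n"
    using comb_baseI[of "\<lambda>_. 0" n x] by simp
  show "comb_base x (Suc n) \<subseteq> comb_base x n"
  proof
    fix y assume "y \<in> comb_base x (Suc n)"
    then obtain a where a: "finite {j. a j \<noteq> 0}" "\<And>j. 2 ^ Suc n * \<bar>a j\<bar> \<le> 2 ^ j"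
      "y = combination x a" by (rule comb_baseE) blast
    have "2 ^ n * \<bar>a j\<bar> \<le> 2 ^ j" for j
      using a(2)[of j] by (simp add: mult.assoc) (smt (verit) mult_nonneg_nonneg zero_le_power)
    with a show "y \<in> comb_base x n"
      by (auto intro: comb_baseI)
  qed
  show "- y \<in> comb_base x n" if "y \<in> comb_base x n" for y
    using that
  proof (rule comb_baseE)
    fix a assume "finite {j. a j \<noteq> 0}" "\<And>j. 2 ^ n * \<bar>a j\<bar> \<le> 2 ^ j" "y = combination x a"
    then show ?thesis
      using comb_baseI[of "\<lambda>j. - a j" n x] by (simp add: combination_minus)
  qed
  show "y + z \<in> comb_base x n" if y: "y \<in> comb_base x (Suc n)" and z: "z \<in> comb_base x (Suc n)"
    for y z
  proof -
    obtain a where a: "finite {j. a j \<noteq> 0}" "\<And>j. 2 ^ Suc n * \<bar>a j\<bar> \<le> 2 ^ j"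
      "y = combination x a" using y by (rule comb_baseE) blast
    obtain b where b: "finite {j. b j \<noteq> 0}" "\<And>j. 2 ^ Suc n * \<bar>b j\<bar> \<le> 2 ^ j"
      "z = combination x b" using z by (rule comb_baseE) blast
    have "2 ^ n * \<bar>a j + b j\<bar> \<le> 2 ^ j" for j
    proof -
      have "2 ^ n * \<bar>a j + b j\<bar> \<le> 2 ^ n * (\<bar>a j\<bar> + \<bar>b j\<bar>)"
        by (intro mult_left_mono) auto
      then show ?thesis
        using a(2)[of j] b(2)[of j] by (simp add: algebra_simps)
    qed
    then have "combination x (\<lambda>j. a j + b j) \<in> comb_base x n"
      by (intro comb_baseI finite_supp_add a b)
    then show ?thesis
      by (simp add: combination_add a b)
  qed
qed

text \<open>The coefficients of \<open>a - b\<close> are at most \<open>2\<^sup>j\<^sup>+\<^sup>1 + 2\<^sup>j \<le> 2\<^sup>j\<^sup>+\<^sup>2\<close>; this is why near independence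
  has the bound \<open>2\<^sup>j\<^sup>+\<^sup>2\<close>.\<close>

lemma nearly_independent_unique:
  assumes "nearly_independent x" "finite {j. a j \<noteq> 0}" "finite {j. b j \<noteq> 0}"
    and "\<And>j. \<bar>a j\<bar> \<le> 2 * 2 ^ j" "\<And>j. \<bar>b j\<bar> \<le> 2 ^ j"
    and "combination x a = combination x b"
  shows "a j = b j"
proof -
  have fb: "finite {j. - b j \<noteq> 0}"
    using assms(3) by simp
  have "combination x (\<lambda>j. a j + - b j) = 0"
    unfolding combination_add[OF assms(2) fb] by (simp add: combination_minus assms(6))
  moreover have "finite {j. a j + - b j \<noteq> 0}"
    by (rule finite_supp_add[OF assms(2) fb])
  moreover have "\<bar>a j + - b j\<bar> \<le> 2 ^ (j + 2)" for j
  proof -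
    have "(0::int) \<le> 2 ^ j"
      by simp
    then show ?thesis
      using assms(4,5)[of j] by simp
  qed
  ultimately have "\<forall>j. a j + - b j = 0"
    using assms(1)[unfolded nearly_independent_def, rule_format, of "\<lambda>j. a j + - b j"]
    unfolding combination_def by blast
  then show ?thesis
    by simp
qed

text \<open>Multiplication by \<open>k\<close> enlarges the coefficients by at most the factor
  \<open>2^n\<close> that level \<open>n\<close> leaves spare. This places
  \<open>comb_base x n\<close> inside the sets \<open>frac_set k (comb_base x 0)\<close> with
  \<open>k \<le> 2^n\<close>.\<close>

lemma nmult_comb_base:
  assumes "y \<in> comb_base x n" "k \<le> 2 ^ n"
  shows "nmult k y \<in> comb_base x 0"
  using assms(1)
proof (rule comb_baseE)
  fix a assume a: "finite {j. a j \<noteq> 0}" "\<And>j. 2 ^ n * \<bar>a j\<bar> \<le> 2 ^ j" "y = combination x a"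
  have k: "int k \<le> 2 ^ n"
    using assms(2) by (metis of_nat_le_iff of_nat_numeral of_nat_power)
  have "\<bar>int k * a j\<bar> \<le> 2 ^ j" for j
    using mult_right_mono[OF k, of "\<bar>a j\<bar>"] a(2)[of j] by (simp add: abs_mult)
  moreover have "finite {j. int k * a j \<noteq> 0}"
    using a(1) by (rule rev_finite_subset) auto
  ultimately have "combination x (\<lambda>j. int k * a j) \<in> comb_base x 0"
    by (intro comb_baseI) auto
  then show ?thesis
    by (simp add: combination_nmult a)
qed

text \<open>A converse to \<open>nmult_comb_base\<close>. Each multiple lying in
  \<open>comb_base x 0\<close> comes with its own coefficient function, and near independence ties
  these to one fixed \<open>a\<close>. Only multiples by powers of two are used.\<close>

lemma frac_comb_base_subset:
  assumes "nearly_independent x"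
  shows "frac_set (2 ^ n) (comb_base x 0) \<subseteq> comb_base x n"
proof
  fix y assume y: "y \<in> frac_set (2 ^ n) (comb_base x 0)"
  have "nmult 1 y \<in> comb_base x 0"
    using y unfolding frac_set_def by (smt (verit) atLeastAtMost_iff le_refl mem_Collect_eq one_le_numeral one_le_power)
  then have "y \<in> comb_base x 0"
    by simp
  then obtain a where a: "finite {j. a j \<noteq> 0}" "\<And>j. 2 ^ 0 * \<bar>a j\<bar> \<le> 2 ^ j" "y = combination x a"
    by (rule comb_baseE) blast
  \<comment> \<open>The coefficients \<open>a\<close> of \<open>y\<close> stay fixed while each
    doubling of the multiple improves their bound by a factor 2.\<close>
  have "2 ^ i * \<bar>a j\<bar> \<le> 2 ^ j" if "i \<le> n" for i j
    using that
  proof (induction i arbitrary: j)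
    case 0
    then show ?case using a(2)[of j] by simp
  next
    case (Suc i)
    have "(2::nat) ^ Suc i \<in> {1..2 ^ n}"
      using Suc.prems power_increasing[of "Suc i" n "2::nat"] by simp
    then have "nmult (2 ^ Suc i) y \<in> comb_base x 0"
      using y unfolding frac_set_def by blast
    then obtain b where b: "finite {j. b j \<noteq> 0}" "\<And>j. 2 ^ 0 * \<bar>b j\<bar> \<le> 2 ^ j"
      "nmult (2 ^ Suc i) y = combination x b"
      by (rule comb_baseE) blast
    have fin: "finite {j. int (2 ^ Suc i) * a j \<noteq> 0}"
      using a(1) by (rule rev_finite_subset) auto
    \<comment> \<open>The bound from level \<open>i\<close> only gives \<open>2 * 2^j\<close> for
      \<open>2^(i+1) * a j\<close>, exactly the slack granted by
      \<open>nearly_independent_unique\<close>; equality with \<open>b j\<close> then removes the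
      factor 2.\<close>
    have bound: "\<bar>int (2 ^ Suc i) * a j\<bar> \<le> 2 * 2 ^ j" for j
      using Suc.IH[of j] Suc.prems by (simp add: abs_mult mult.assoc)
    have eq: "combination x (\<lambda>j. int (2 ^ Suc i) * a j) = combination x b"
      using combination_nmult[OF a(1), of x "2 ^ Suc i"] a(3) b(3) by simp
    have "int (2 ^ Suc i) * a j = b j"
      by (rule nearly_independent_unique[OF assms fin b(1) bound _ eq]) (use b(2) in simp)
    then show ?case
      using b(2)[of j] by (metis abs_mult abs_of_nat mult_1 of_nat_numeral of_nat_power power_0)
  qed
  with a show "y \<in> comb_base x n"
    by (auto intro: comb_baseI)
qed


section \<open>Translation-invariant metrics\<close>

lemma geometric_less:
  fixes c r :: real
  assumes "r > 0"
  shows "\<exists>n. c / 2 ^ n < r"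
proof -
  have "(\<lambda>n. c / 2 ^ n) \<longlonglongrightarrow> 0"
    by (rule LIMSEQ_divide_realpow_zero) simp
  from order_tendstoD(2)[OF this assms] show ?thesis
    by (auto simp: eventually_sequentially)
qed

locale translation_invariant_metric = Metric_space UNIV d
  for d :: "'a::ab_group_add \<Rightarrow> 'a \<Rightarrow> real" +
  assumes invariant: "d (x + z) (y + z) = d x y"
begin

section \<open>Values of sums and multiples under an invariant metric\<close>

lemma d_diff: "d x y = d (x - y) 0"
  using invariant[of "x - y" y 0] by simp

lemma d_uminus: "d (- x) 0 = d x 0"
  using invariant[of "- x" x 0] by (simp add: commute)

lemma d_add_le: "d (x + y) 0 \<le> d x 0 + d y 0"
  using triangle[of "x + y" y 0] invariant[of x y 0] by simp

lemma d_nmult_le: "d (nmult n x) 0 \<le> real n * d x 0"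
proof (induction n)
  case (Suc n)
  then show ?case
    using d_add_le[of x "nmult n x"] by (simp add: algebra_simps)
qed simp

lemma d_zmult_le: "d (zmult k x) 0 \<le> \<bar>real_of_int k\<bar> * d x 0"
  using d_nmult_le[of "nat \<bar>k\<bar>" x] by (auto simp: zmult_def d_uminus)

lemma d_sum_le: "d (sum f A) 0 \<le> (\<Sum>j\<in>A. d (f j) 0)"
proof (induction A rule: infinite_finite_induct)
  case (insert j A)
  then show ?case
    using d_add_le[of "f j" "sum f A"] by simp
qed simp_all

section \<open>Metric neighbourhoods as translates of balls at zero\<close>

lemma nbhd_zero_mtopology: "nbhd_zero mtopology W \<longleftrightarrow> (\<exists>r>0. \<forall>x. d x 0 < r \<longrightarrow> x \<in> W)"
proof
  assume "nbhd_zero mtopology W"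
  then obtain V where V: "openin mtopology V" "0 \<in> V" "V \<subseteq> W"
    unfolding nbhd_zero_def by blast
  then obtain r where "r > 0" "mball 0 r \<subseteq> V"
    unfolding openin_mtopology by blast
  with V(3) show "\<exists>r>0. \<forall>x. d x 0 < r \<longrightarrow> x \<in> W"
    by (intro exI[of _ r]) (auto simp: subset_iff commute)
next
  assume "\<exists>r>0. \<forall>x. d x 0 < r \<longrightarrow> x \<in> W"
  then obtain r where "r > 0" "\<And>x. d x 0 < r \<Longrightarrow> x \<in> W" by blast
  then show "nbhd_zero mtopology W"
    unfolding nbhd_zero_def
    by (intro exI[of _ "mball 0 r"]) (auto simp: commute)
qed

text \<open>Translating balls to 0 brings openness into the shape of
  \<open>openin_base_topology\<close>, so that the two kinds of topology can be compared.\<close>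

lemma openin_mtopology_iff:
  "openin mtopology V \<longleftrightarrow> (\<forall>x\<in>V. \<exists>r>0. \<forall>u. d u 0 < r \<longrightarrow> x + u \<in> V)"
proof -
  have "mball x r \<subseteq> V \<longleftrightarrow> (\<forall>u. d u 0 < r \<longrightarrow> x + u \<in> V)" for x r
  proof
    assume "mball x r \<subseteq> V"
    moreover have "x + u \<in> mball x r" if "d u 0 < r" for u
      using that d_diff[of "x + u" x] by (simp add: commute)
    ultimately show "\<forall>u. d u 0 < r \<longrightarrow> x + u \<in> V" by blast
  next
    assume V: "\<forall>u. d u 0 < r \<longrightarrow> x + u \<in> V"
    show "mball x r \<subseteq> V"
    proof
      fix y assume "y \<in> mball x r"
      then have "d (y - x) 0 < r"
        using d_diff[of y x] by (simp add: commute)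
      then have "x + (y - x) \<in> V"
        using V by blast
      then show "y \<in> V" by simp
    qed
  qed
  then show ?thesis
    unfolding openin_mtopology by auto
qed

section \<open>Small elements of large order, the minima, and the greedy choice\<close>

lemma small_element_of_large_order:
  assumes "\<not> locally_bounded mtopology" "r > 0"
  obtains x where "d x 0 < r" "\<And>k. k \<in> {1..N} \<Longrightarrow> nmult k x \<noteq> 0"
proof -
  \<comment> \<open>The factorial is a common multiple of all \<open>k\<close> in
    \<open>{1..N}\<close>, so a single torsion subgroup handles every order to be avoided.\<close>
  have "\<not> openin mtopology (torsion_part (fact N))"
    using assms(1) fact_ge_1[of N, where 'a = nat] unfolding locally_bounded_def by blast
  \<comment> \<open>Openness fails at some point \<open>y\<close>, not necessarily at 0; since
    \<open>N! y = 0\<close>, additivity gives \<open>N! (y + u) = N! u\<close>.\<close>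
  then obtain y where y: "nmult (fact N) y = 0"
    "\<And>r. r > 0 \<Longrightarrow> \<exists>u. d u 0 < r \<and> nmult (fact N) (y + u) \<noteq> 0"
    unfolding openin_mtopology_iff torsion_part_def by auto
  then obtain u where u: "d u 0 < r" "nmult (fact N) u \<noteq> 0"
    using assms(2) by (auto simp: nmult_add_right)
  have "nmult k u \<noteq> 0" if k: "k \<in> {1..N}" for k
  proof -
    have "k dvd fact N"
      using k by (simp add: dvd_fact)
    then obtain m where "fact N = m * k"
      by (metis dvd_def mult.commute)
    with u(2) show ?thesis
      by (auto simp: nmult_mult)
  qed
  with u(1) show ?thesis
    using that by blast
qed

text \<open>The unit coefficient vector at \<open>n\<close> competes in the minimum. The upper bound
  in almost independence thus holds for every sequence.\<close>

lemma eps_le: "eps d x n \<le> d (x n) 0"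
proof -
  have "zmult (((\<lambda>_. 0)(n := 1)) j) (x j) = (if j = n then x n else 0)" for j
    by auto
  then have "d (x n) 0 = d (\<Sum>j\<le>n. zmult (((\<lambda>_. 0)(n := 1)) j) (x j)) 0"
    by simp
  moreover have "\<forall>j\<le>n. \<bar>((\<lambda>_. 0)(n := 1 :: int)) j\<bar> \<le> 2 ^ (j + 2)"
    by (auto simp: one_le_power simp del: power_Suc)
  ultimately have "d (x n) 0 \<in> eps_values d x n"
    unfolding eps_values_def
    by (intro CollectI exI[of _ "(\<lambda>_. 0)(n := 1)"] conjI exI[of _ n]) auto
  then show ?thesis
    unfolding eps_def by (intro Min_le finite_eps_values)
qed

lemma eps_pos_iff:
  "eps d x n > 0 \<longleftrightarrow> (\<forall>a :: nat \<Rightarrow> int. (\<forall>j\<le>n. \<bar>a j\<bar> \<le> 2 ^ (j + 2)) \<longrightarrow>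
     (\<Sum>j\<le>n. zmult (a j) (x j)) = 0 \<longrightarrow> (\<forall>j\<le>n. a j = 0))"
proof -
  have pos: "d y 0 > 0 \<longleftrightarrow> y \<noteq> 0" for y
    using zero[of y 0] nonneg[of y 0] by auto
  have "eps d x n > 0 \<longleftrightarrow> (\<forall>r\<in>eps_values d x n. r > 0)"
    unfolding eps_def by (rule Min_gr_iff[OF finite_eps_values eps_values_nonempty])
  also have "\<dots> \<longleftrightarrow> (\<forall>a :: nat \<Rightarrow> int. (\<forall>j\<le>n. \<bar>a j\<bar> \<le> 2 ^ (j + 2)) \<longrightarrow> (\<exists>j\<le>n. a j \<noteq> 0) \<longrightarrow>
     d (\<Sum>j\<le>n. zmult (a j) (x j)) 0 > 0)"
    unfolding eps_values_def by blast
  finally show ?thesis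
    unfolding pos by blast
qed

lemma eps_lower:
  assumes "\<And>j. j \<le> n \<Longrightarrow> \<bar>a j\<bar> \<le> 2 ^ (j + 2)" "\<exists>j\<le>n. a j \<noteq> 0"
  shows "eps d x n \<le> d (\<Sum>j\<le>n. zmult (a j) (x j)) 0"
  unfolding eps_def
  by (rule Min_le[OF finite_eps_values]) (use assms in \<open>auto simp: eps_values_def\<close>)

text \<open>Since \<open>eps d x n\<close> depends only on the terms up to \<open>n\<close>, it can
  steer a recursive choice.\<close>

lemma eps_cong:
  assumes "\<And>j. j \<le> n \<Longrightarrow> x j = y j"
  shows "eps d x n = eps d y n"
proof -
  have "(\<Sum>j\<le>n. zmult (a j) (x j)) = (\<Sum>j\<le>n. zmult (a j) (y j))" for a
    by (intro sum.cong) (auto simp: assms)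
  then show ?thesis
    unfolding eps_def eps_values_def by simp
qed

text \<open>The demands on a candidate \<open>y\<close> for position \<open>n\<close>, referring
  only to terms of \<open>x\<close> before \<open>n\<close>: no multiple within the coefficient
  bound vanishes, and the strict inequality of almost independence holds, shifted by one index and
  vacuous at \<open>n = 0\<close>.\<close>

definition admissible :: "(nat \<Rightarrow> 'a) \<Rightarrow> nat \<Rightarrow> 'a \<Rightarrow> bool" where
  "admissible x n y \<longleftrightarrow> (\<forall>k\<in>{1..2 ^ (n + 2)}. nmult k y \<noteq> 0) \<and>
     (\<forall>m. n = Suc m \<longrightarrow> 2 ^ (m + 3) * d y 0 < eps d x m)"

lemma zmult_admissible:
  assumes "admissible x n y" "\<bar>a\<bar> \<le> 2 ^ (n + 2)" "zmult a y = 0"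
  shows "a = 0"
proof (rule ccontr)
  assume "a \<noteq> 0"
  have "nat \<bar>a\<bar> \<le> 2 ^ (n + 2)"
    using assms(2) by (simp add: nat_le_iff)
  then have "nmult (nat \<bar>a\<bar>) y \<noteq> 0"
    using assms(1) \<open>a \<noteq> 0\<close> unfolding admissible_def by auto
  with assms(3) show False
    by (auto simp: zmult_def split: if_splits)
qed

text \<open>In a vanishing combination the terms before the last sum to minus the last one, whose
  value is too small for a nontrivial combination. The last term then vanishes alone, and the order
  condition makes its coefficient zero.\<close>

lemma eps_pos:
  assumes "\<And>j. j \<le> n \<Longrightarrow> admissible x j (x j)"
  shows "eps d x n > 0"
  using assms
proof (induction n)
  case 0
  then show ?case
    unfolding eps_pos_iff using zmult_admissible[of x 0 "x 0"] by auto
next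
  case (Suc n)
  show ?case
    unfolding eps_pos_iff
  proof (rule allI, rule impI, rule impI)
    fix a :: "nat \<Rightarrow> int"
    assume a: "\<forall>j\<le>Suc n. \<bar>a j\<bar> \<le> 2 ^ (j + 2)"
      and sum: "(\<Sum>j\<le>Suc n. zmult (a j) (x j)) = 0"
    let ?s = "\<Sum>j\<le>n. zmult (a j) (x j)"
    \<comment> \<open>The coefficient bound at index \<open>Suc n\<close> is
      \<open>2^(Suc n + 2)\<close>, which is the source of the factor \<open>2^(n+3)\<close> in
      almost independence.\<close>
    have "real_of_int \<bar>a (Suc n)\<bar> \<le> real_of_int (2 ^ (Suc n + 2))"
      using a by (subst of_int_le_iff) blast
    then have an: "\<bar>real_of_int (a (Suc n))\<bar> \<le> 2 ^ (n + 3)"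
      by (simp add: numeral_3_eq_3)
    have "?s = - zmult (a (Suc n)) (x (Suc n))"
      using sum by (simp add: eq_neg_iff_add_eq_0)
    then have "d ?s 0 = d (zmult (a (Suc n)) (x (Suc n))) 0"
      by (simp add: d_uminus)
    also have "\<dots> \<le> 2 ^ (n + 3) * d (x (Suc n)) 0"
      using d_zmult_le[of "a (Suc n)" "x (Suc n)"] mult_right_mono[OF an nonneg[of "x (Suc n)" 0]]
      by linarith
    also have "\<dots> < eps d x n"
      using Suc.prems[of "Suc n"] unfolding admissible_def by blast
    finally have "\<not> eps d x n \<le> d ?s 0"
      by simp
    then have zero: "\<forall>j\<le>n. a j = 0"
      using eps_lower[of n a x] a by (meson le_SucI)
    with sum have "zmult (a (Suc n)) (x (Suc n)) = 0"
      by simp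
    then have "a (Suc n) = 0"
      using zmult_admissible[OF Suc.prems[of "Suc n"]] a by blast
    with zero show "\<forall>j\<le>Suc n. a j = 0"
      by (auto simp: le_Suc_eq)
  qed
qed

text \<open>A finite support lies below some \<open>n\<close>, so near independence follows from
  positivity of all the minima.\<close>

lemma admissible_imp_almost_independent:
  assumes "\<And>n. admissible x n (x n)"
  shows "almost_independent d x"
proof -
  have "nearly_independent x"
    unfolding nearly_independent_def combination_def[symmetric]
  proof (rule allI, rule impI, rule impI, rule impI)
    fix a :: "nat \<Rightarrow> int"
    assume fin: "finite {j. a j \<noteq> 0}" and a: "\<forall>j. \<bar>a j\<bar> \<le> 2 ^ (j + 2)"
      and zero: "combination x a = 0"
    obtain n where n: "{j. a j \<noteq> 0} \<subseteq> {..n}"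
      using fin finite_nat_iff_bounded_le by blast
    then have "(\<Sum>j\<le>n. zmult (a j) (x j)) = 0"
      using combination_superset[OF _ n, of x] zero by simp
    then have "\<forall>j\<le>n. a j = 0"
      using eps_pos[of n x] assms a unfolding eps_pos_iff by blast
    with n show "\<forall>j. a j = 0"
      by auto
  qed
  moreover have "2 ^ (n + 3) * d (x (n + 1)) 0 < eps d x n" for n
    using assms[of "Suc n"] unfolding admissible_def by simp
  ultimately show ?thesis
    unfolding almost_independent_def using eps_le by blast
qed

lemma not_locally_bounded_imp_almost_independent:
  assumes "\<not> locally_bounded mtopology"
  shows "\<exists>x. almost_independent d x"
proof -
  \<comment> \<open>Choice along the natural numbers: admissibility at \<open>n\<close> must depend
    on earlier terms only, and be satisfiable once the earlier terms are admissible.\<close>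
  have "\<exists>x. \<forall>n. admissible x n (x n)"
  proof (rule dependent_wellorder_choice)
    fix r n and x y :: "nat \<Rightarrow> 'a"
    assume eq: "\<And>j. j < n \<Longrightarrow> x j = y j"
    have "eps d x m = eps d y m" if "n = Suc m" for m
      by (rule eps_cong) (use eq that in simp)
    then show "admissible x n r = admissible y n r"
      unfolding admissible_def by auto
  next
    fix n and x :: "nat \<Rightarrow> 'a"
    assume adm: "\<And>j. j < n \<Longrightarrow> admissible x j (x j)"
    show "\<exists>r. admissible x n r"
    proof (cases n)
      case 0
      obtain r :: 'a where "\<And>k. k \<in> {1..2 ^ (n + 2)} \<Longrightarrow> nmult k r \<noteq> 0"
        using small_element_of_large_order[OF assms zero_less_one, of "2 ^ (n + 2)"] by metis
      with 0 show ?thesis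
        unfolding admissible_def by (intro exI[of _ r]) auto
    next
      case (Suc m)
      then have "eps d x m / 2 ^ (m + 3) > 0"
        using eps_pos[of m x] adm by simp
      then obtain r where r: "d r 0 < eps d x m / 2 ^ (m + 3)"
        "\<And>k. k \<in> {1..2 ^ (n + 2)} \<Longrightarrow> nmult k r \<noteq> 0"
        using small_element_of_large_order[OF assms, of _ "2 ^ (n + 2)"] by metis
      have "2 ^ (m + 3) * d r 0 < eps d x m"
        using r(1) by (simp add: pos_less_divide_eq mult.commute)
      with r(2) Suc show ?thesis
        unfolding admissible_def by (intro exI[of _ r]) auto
    qed
  qed
  then show ?thesis
    using admissible_imp_almost_independent by blast
qed

section \<open>The finer topology generated by an almost independent sequence\<close>

lemma almost_independent_step:
  assumes "almost_independent d x"
  shows "2 ^ (n + 3) * d (x (n + 1)) 0 < d (x n) 0"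
  using assms unfolding almost_independent_def by (meson less_le_trans)

text \<open>The factor \<open>2^(n+3) = 4 * 2^(n+1)\<close> makes \<open>2^n * d (x n) 0\<close>
  shrink at least fourfold per step, of which only a halving is kept. The weight \<open>2^n\<close>
  is the largest coefficient of \<open>x n\<close> allowed in \<open>comb_base x 0\<close>.\<close>

lemma almost_independent_decay:
  assumes "almost_independent d x"
  shows "2 ^ n * d (x n) 0 \<le> d (x 0) 0 / 2 ^ n"
proof (induction n)
  case (Suc n)
  have "2 ^ (n + 3) * d (x (n + 1)) 0 < d (x n) 0"
    by (rule almost_independent_step[OF assms])
  then have "4 * (2 ^ Suc n * d (x (Suc n)) 0) \<le> d (x n) 0"
    by (simp add: power_add)
  also have "\<dots> \<le> 2 ^ n * d (x n) 0"
    using mult_right_mono[of 1 "2 ^ n" "d (x n) 0"] by simp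
  also have "\<dots> \<le> d (x 0) 0 / 2 ^ n"
    by (rule Suc.IH)
  finally have "2 ^ Suc n * d (x (Suc n)) 0 \<le> d (x 0) 0 / 2 ^ n / 4"
    by simp
  also have "\<dots> \<le> d (x 0) 0 / 2 ^ Suc n"
    by (simp add: field_simps)
  finally show ?case .
qed simp

text \<open>Decay outweighs the growing coefficients: the \<open>j\<close>-th term has value at most
  \<open>d (x 0) 0 / 2^n * (1/2)^j\<close>, and the geometric series contributes the factor 2. Basic
  sets therefore shrink into metric balls.\<close>

lemma d_comb_base_le:
  assumes "almost_independent d x" "y \<in> comb_base x n"
  shows "d y 0 \<le> 2 * d (x 0) 0 / 2 ^ n"
  using assms(2)
proof (rule comb_baseE)
  fix a assume a: "finite {j. a j \<noteq> 0}" "\<And>j. 2 ^ n * \<bar>a j\<bar> \<le> 2 ^ j" "y = combination x a"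
  let ?A = "{j. a j \<noteq> 0}"
  have bound: "d (zmult (a j) (x j)) 0 \<le> d (x 0) 0 / 2 ^ n * (1 / 2) ^ j" for j
  proof -
    have "real_of_int (2 ^ n * \<bar>a j\<bar>) \<le> real_of_int (2 ^ j)"
      by (subst of_int_le_iff) (rule a(2))
    then have "2 ^ n * \<bar>real_of_int (a j)\<bar> \<le> 2 ^ j"
      by simp
    then have "2 ^ n * \<bar>real_of_int (a j)\<bar> * d (x j) 0 \<le> 2 ^ j * d (x j) 0"
      by (rule mult_right_mono) simp
    also have "\<dots> \<le> d (x 0) 0 / 2 ^ j"
      by (rule almost_independent_decay[OF assms(1)])
    finally have "\<bar>real_of_int (a j)\<bar> * d (x j) 0 \<le> d (x 0) 0 / 2 ^ n * (1 / 2) ^ j"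
      by (simp add: field_simps)
    then show ?thesis
      using d_zmult_le[of "a j" "x j"] by linarith
  qed
  have "(\<Sum>j\<in>?A. (1 / 2 :: real) ^ j) \<le> (\<Sum>j. (1 / 2) ^ j)"
    by (rule sum_le_suminf) (use a(1) in \<open>auto intro: summable_geometric\<close>)
  also have "(\<Sum>j. (1 / 2 :: real) ^ j) = 2"
    by (subst suminf_geometric) auto
  finally have geometric: "(\<Sum>j\<in>?A. (1 / 2 :: real) ^ j) \<le> 2" .
  have "d y 0 \<le> (\<Sum>j\<in>?A. d (zmult (a j) (x j)) 0)"
    unfolding a(3) combination_def by (rule d_sum_le)
  also have "\<dots> \<le> (\<Sum>j\<in>?A. d (x 0) 0 / 2 ^ n * (1 / 2) ^ j)"
    by (intro sum_mono bound)
  also have "\<dots> = d (x 0) 0 / 2 ^ n * (\<Sum>j\<in>?A. (1 / 2) ^ j)"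
    by (simp add: sum_distrib_left)
  also have "\<dots> \<le> d (x 0) 0 / 2 ^ n * 2"
    by (rule mult_left_mono[OF geometric]) simp
  finally show ?thesis
    by (simp add: mult.commute)
qed

lemma almost_independent_imp_strictly_finer_UFSS:
  assumes "almost_independent d x"
  shows "\<exists>T'. UFSS T' \<and> \<not> is_discrete T' \<and> strictly_finer_than T' mtopology"
proof (intro exI conjI)
  let ?T = "comb.base_topology x"
  have near: "nearly_independent x"
    using assms unfolding almost_independent_def by blast
  have small: "\<exists>n. \<forall>u\<in>comb_base x n. d u 0 < r" if "r > 0" for r
  proof -
    obtain n where n: "2 * d (x 0) 0 / 2 ^ n < r"
      using geometric_less[OF \<open>r > 0\<close>] by blast
    have "\<forall>u\<in>comb_base x n. d u 0 < r"
      by (intro ballI le_less_trans[OF d_comb_base_le[OF assms] n])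
    then show ?thesis ..
  qed
  have finer: "openin ?T V" if "openin mtopology V" for V
    unfolding comb.openin_base_topology
  proof
    fix y assume "y \<in> V"
    then obtain r where "r > 0" "\<And>u. d u 0 < r \<Longrightarrow> y + u \<in> V"
      using \<open>openin mtopology V\<close> unfolding openin_mtopology_iff by blast
    with small[of r] show "\<exists>n. \<forall>u\<in>comb_base x n. y + u \<in> V"
      by blast
  qed
  \<comment> \<open>Disjoint open sets separating two points in the metric topology remain open in
    the finer one.\<close>
  have "Hausdorff_space ?T"
    using Hausdorff_space_mtopology finer unfolding Hausdorff_space_def by simp metis
  moreover have "nbhd_zero ?T (frac_set n (comb_base x 0))" for n
  proof -
    have "k \<le> 2 ^ n" if "k \<le> n" for k
      using that less_exp[of n] by linarith
    then have "comb_base x n \<subseteq> frac_set n (comb_base x 0)"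
      unfolding frac_set_def by (auto intro: nmult_comb_base)
    then show ?thesis
      unfolding comb.nbhd_zero_base_topology by blast
  qed
  moreover have "\<exists>n\<ge>1. frac_set n (comb_base x 0) \<subseteq> W" if "nbhd_zero ?T W" for W
  proof -
    obtain n where "comb_base x n \<subseteq> W"
      using \<open>nbhd_zero ?T W\<close> unfolding comb.nbhd_zero_base_topology by blast
    then show ?thesis
      using frac_comb_base_subset[OF near, of n] by (intro exI[of _ "2 ^ n"]) auto
  qed
  moreover have "uminus ` comb_base x 0 = comb_base x 0"
    using comb.uminus_mem[of _ x 0] by (force simp: image_iff)
  moreover have nbhd: "nbhd_zero ?T (comb_base x 0)"
    unfolding comb.nbhd_zero_base_topology by blast
  ultimately show "UFSS ?T"
    unfolding UFSS_def using comb.group_topology_base_topology by blast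
  have nonzero: "x n \<noteq> 0" for n
  proof -
    have "0 \<le> 2 ^ (n + 3) * d (x (n + 1)) 0"
      by simp
    also have "\<dots> < d (x n) 0"
      by (rule almost_independent_step[OF assms])
    finally show ?thesis
      by auto
  qed
  show "\<not> is_discrete ?T"
    unfolding is_discrete_iff_nbhd_zero[OF comb.group_topology_base_topology]
      comb.nbhd_zero_base_topology
  proof
    assume "\<exists>n. comb_base x n \<subseteq> {0}"
    then obtain n where n: "comb_base x n \<subseteq> {0}" ..
    \<comment> \<open>The point \<open>x n\<close> itself lies in the \<open>n\<close>-th basic set,
      where its coefficient bound is \<open>2^n / 2^n = 1\<close>.\<close>
    have "combination x ((\<lambda>_. 0)(n := 1)) \<in> comb_base x n"
      by (rule comb_baseI) auto
    with n nonzero show False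
      by (auto simp: combination_single)
  qed
  have "\<not> nbhd_zero mtopology (comb_base x 0)"
  proof
    assume "nbhd_zero mtopology (comb_base x 0)"
    then obtain r where r: "r > 0" "\<And>y. d y 0 < r \<Longrightarrow> y \<in> comb_base x 0"
      unfolding nbhd_zero_mtopology by blast
    obtain n where n: "2 * d (x 0) 0 / 2 ^ n < r"
      using geometric_less[OF r(1)] by blast
    \<comment> \<open>The coefficient \<open>2 * 2^n\<close> exceeds the bound \<open>2^n\<close> of
      \<open>comb_base x 0\<close> but stays within reach of
      \<open>nearly_independent_unique\<close>, while decay keeps the value of the point below
      \<open>r\<close>.\<close>
    let ?a = "(\<lambda>_. 0)(n := 2 * 2 ^ n :: int)"
    have "d (combination x ?a) 0 \<le> 2 * (2 ^ n * d (x n) 0)"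
      using d_zmult_le[of "2 * 2 ^ n" "x n"] by (simp add: combination_single)
    then have "d (combination x ?a) 0 < r"
      using almost_independent_decay[OF assms, of n] n by simp
    then have "combination x ?a \<in> comb_base x 0"
      by (rule r(2))
    then obtain b where b: "finite {j. b j \<noteq> 0}" "\<And>j. 2 ^ 0 * \<bar>b j\<bar> \<le> 2 ^ j"
      "combination x ?a = combination x b"
      by (rule comb_baseE) blast
    have "?a n = b n"
      by (rule nearly_independent_unique[OF near _ b(1) _ _ b(3)]) (use b(2) in auto)
    then show False
      using b(2)[of n] zero_less_power[of "2 :: int" n] by (simp del: zero_less_power)
  qed
  with nbhd have "?T \<noteq> mtopology"
    by metis
  with finer show "strictly_finer_than ?T mtopology"
    unfolding strictly_finer_than_def finer_than_def by simp
qed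

text \<open>An open \<open>torsion_part n\<close> stays open in the finer topology, where UFSS would
  force discreteness.\<close>

lemma finer_UFSS_imp_not_locally_bounded:
  assumes "UFSS T'" "\<not> is_discrete T'" "finer_than T' T"
  shows "\<not> locally_bounded T"
  using assms UFSS_torsion_open_imp_discrete unfolding locally_bounded_def finer_than_def by blast

end

theorem theorem4p21:
  fixes T :: "'a::ab_group_add topology"
    and d :: "'a \<Rightarrow> 'a \<Rightarrow> real"
  assumes "group_topology T"
    and "Metric_space UNIV d"
    and "T = Metric_space.mtopology UNIV d"
    and "\<And>x y z. d (x + z) (y + z) = d x y"
    and "\<not> is_discrete T"
  shows "(\<not> locally_bounded T
            \<longleftrightarrow> (\<exists>T'. UFSS T' \<and> \<not> is_discrete T' \<and> finer_than T' T))
       \<and> (\<not> locally_bounded T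
            \<longleftrightarrow> (\<exists>T'. UFSS T' \<and> \<not> is_discrete T' \<and> strictly_finer_than T' T))
       \<and> (\<not> locally_bounded T \<longleftrightarrow> (\<exists>x. almost_independent d x))"
proof -
  interpret translation_invariant_metric d
    by (intro translation_invariant_metric.intro translation_invariant_metric_axioms.intro assms(2,4))
  \<comment> \<open>The equivalences come from the cycle (i), (iv), (iii), (ii), (i).\<close>
  have "\<not> locally_bounded T \<Longrightarrow> \<exists>x. almost_independent d x"
    unfolding assms(3) by (rule not_locally_bounded_imp_almost_independent)
  moreover have "\<exists>x. almost_independent d x \<Longrightarrow>
      \<exists>T'. UFSS T' \<and> \<not> is_discrete T' \<and> strictly_finer_than T' T"
    unfolding assms(3) using almost_independent_imp_strictly_finer_UFSS by blast
  moreover have "\<exists>T'. UFSS T' \<and> \<not> is_discrete T' \<and> strictly_finer_than T' T \<Longrightarrow>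
      \<exists>T'. UFSS T' \<and> \<not> is_discrete T' \<and> finer_than T' T"
    unfolding strictly_finer_than_def by blast
  moreover have "\<exists>T'. UFSS T' \<and> \<not> is_discrete T' \<and> finer_than T' T \<Longrightarrow> \<not> locally_bounded T"
    using finer_UFSS_imp_not_locally_bounded by blast
  ultimately show ?thesis
    by blast
qed

end
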